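(* Let $n, r \geq 1$. Then \[ \mathcal{S}_{(r,n)}(x) = (-1)^{r} r!\, \frac{(x-1)^{r+n} - x^{n+1} \psi_{(r,n)}(x)}{(n+1) \cdots (n+r)}, \] where \[ \psi_{(r,n)}(x) = \sum_{k=0}^{r-1} \binom{n+k}{k} (-1)^k (x-1)^{r-1-k} = \sum_{k=0}^{r-1} \binom{n+r}{k} (-1)^k x^{r-1-k}. \] In particular: (i) $\mathcal{S}_{(1,n)}(x) = \frac{x^{n+1}-(x-1)^{n+1}}{n+1}$; (ii) $\mathcal{S}_{(r,1)}(x) = x - \frac{1}{r+1}$; (iii) $\mathcal{S}_{(r,n)}(2) = (-1)^{r} r!\, \frac{1 - 2^{n+1} \sum_{k=0}^{r-1} (-1)^k \binom{n+k}{k}}{(n+1) \cdots (n+r)}$.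
   Context: For integers $n, r \geq 0$, $\mathcal{S}_{(r,n)}(x) = \sum_{k=0}^{n} \binom{n}{k} (-1)^k x^{n-k} \binom{r+k}{r}^{-1} \in \mathbb{Q}[x]$. *)

theory Defs
  imports Complex_Main "HOL-Computational_Algebra.Polynomial"
begin

definition S_poly :: "nat \<Rightarrow> nat \<Rightarrow> rat poly" where
  "S_poly r n =
    (\<Sum>k=0..n. monom (of_nat (n choose k) * (-1) ^ k * inverse (of_nat ((r + k) choose r))) (n - k))"

(* The index range {..<r} is 0, ..., r - 1 for r \<ge> 1, so r - 1 - k is never truncated.
   [:-1, 1:] is x - 1. *)
definition psi_poly :: "nat \<Rightarrow> nat \<Rightarrow> rat poly" where
  "psi_poly r n =
    (\<Sum>k<r. smult (of_nat ((n + k) choose k) * (-1) ^ k) ([:-1, 1:] ^ (r - 1 - k)))"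

end

theory Submission
  imports Defs
begin

text \<open>The coefficient identity \<open>(n choose k) / (r+k choose r) = (n+r choose r+k) / (n+r choose r)\<close>
  turns \<open>S_poly r n\<close>, up to the factor \<open>(-1)^r (n+r choose r)\<close>, into the part of the binomial
  expansion of \<open>(x-1)^(n+r)\<close> of degree at most \<open>n\<close>. The remaining part is \<open>x^(n+1)\<close> times a
  polynomial which by Pascal's rule satisfies the same recurrence in \<open>r\<close> as \<open>psi_poly r n\<close>.\<close>

text \<open>Cut the binomial expansion at \<open>j = r\<close>: the terms with \<open>j < r\<close>
  have exponent at least \<open>n + 1\<close>, and the others, reindexed by
  \<open>j = r + k\<close>, share the sign \<open>(-1) ^ r\<close>.\<close>

lemma binomial_diff_one_split:
  fixes x :: "'a::comm_ring_1"
  shows "(x - 1) ^ (r + n) =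
    x ^ (n + 1) * (\<Sum>k<r. of_nat ((n + r) choose k) * (-1) ^ k * x ^ (r - 1 - k))
    + (-1) ^ r * (\<Sum>k\<le>n. of_nat ((n + r) choose (r + k)) * (-1) ^ k * x ^ (n - k))"
proof -
  define f where "f j = of_nat ((n + r) choose j) * (-1) ^ j * x ^ (n + r - j)" for j
  have "(x - 1) ^ (r + n) = (\<Sum>j\<le>n + r. f j)"
    using binomial_ring[of "-1" x "n + r"] by (simp add: f_def add.commute)
  also have "{..n + r} = {..<r} \<union> {r..n + r}" by auto
  also have "sum f \<dots> = sum f {..<r} + sum f {r..n + r}"
    by (rule sum.union_disjoint) auto
  also have "sum f {r..n + r} = (\<Sum>k\<le>n. f (r + k))"
    using sum.shift_bounds_cl_nat_ivl[of f 0 r n] by (simp add: atMost_atLeast0 add.commute)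
  also have "\<dots> = (-1) ^ r * (\<Sum>k\<le>n. of_nat ((n + r) choose (r + k)) * (-1) ^ k * x ^ (n - k))"
    unfolding sum_distrib_left
    by (intro sum.cong refl) (simp add: f_def power_add mult_ac)
  also have "sum f {..<r} =
      x ^ (n + 1) * (\<Sum>k<r. of_nat ((n + r) choose k) * (-1) ^ k * x ^ (r - 1 - k))"
    unfolding sum_distrib_left
  proof (intro sum.cong refl)
    fix k assume "k \<in> {..<r}"
    then have "n + r - k = (n + 1) + (r - 1 - k)" by auto
    then show "f k = x ^ (n + 1) * (of_nat ((n + r) choose k) * (-1) ^ k * x ^ (r - 1 - k))"
      unfolding f_def by (simp only: power_add mult_ac)
  qed
  finally show ?thesis .
qed

text \<open>Both sides vanish at \<open>r = 0\<close> and, passing from \<open>r\<close> to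
  \<open>Suc r\<close>, are multiplied by \<open>x - 1\<close> and increased by
  \<open>(-1) ^ r * of_nat ((n + r) choose r)\<close>.\<close>

lemma sum_binomial_diff_one_powers:
  fixes x :: "'a::comm_ring_1"
  shows "(\<Sum>k<r. of_nat ((n + k) choose k) * (-1) ^ k * (x - 1) ^ (r - 1 - k)) =
    (\<Sum>k<r. of_nat ((n + r) choose k) * (-1) ^ k * x ^ (r - 1 - k))"
proof (induction r)
  case (Suc r)
  let ?P = "\<lambda>r. \<Sum>k<r. of_nat ((n + k) choose k) * (-1) ^ k * (x - 1) ^ (r - 1 - k)"
  let ?T = "\<lambda>r. \<Sum>k<r. of_nat ((n + r) choose k) * (-1) ^ k * x ^ (r - 1 - k)"
  let ?c = "of_nat ((n + r) choose r) * (-1) ^ r :: 'a"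
  \<comment> \<open>This is used with \<open>y = x - 1\<close> for \<open>?P\<close> and with
    \<open>y = x\<close> for \<open>?T\<close>.\<close>
  have shift: "(\<Sum>k<r. a k * y ^ (r - k)) = y * (\<Sum>k<r. a k * y ^ (r - 1 - k))"
    for a :: "nat \<Rightarrow> 'a" and y
    unfolding sum_distrib_left
  proof (intro sum.cong refl)
    fix k assume "k \<in> {..<r}"
    then have "r - k = Suc (r - 1 - k)" by auto
    then show "a k * y ^ (r - k) = y * (a k * y ^ (r - 1 - k))"
      by (simp only: power_Suc mult_ac)
  qed
  have "?P (Suc r) = (x - 1) * ?P r + ?c"
    by (simp add: shift)
  also have "\<dots> = x * ?T r + ?c - ?T r"
    unfolding Suc.IH by (simp add: left_diff_distrib)
  also have "x * ?T r + ?c = (\<Sum>k<Suc r. of_nat ((n + r) choose k) * (-1) ^ k * x ^ (r - k))"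
    by (simp add: shift)
  \<comment> \<open>Splitting off the term \<open>k = 0\<close> aligns the remaining powers of
    \<open>x\<close> with those of \<open>?T r\<close>; the subtraction then adds neighbouring
    coefficients of equal sign, which Pascal's rule merges.\<close>
  also have "\<dots> = x ^ r + (\<Sum>k<r. of_nat ((n + r) choose Suc k) * (-1) ^ Suc k * x ^ (r - Suc k))"
    by (subst sum.lessThan_Suc_shift) simp
  also have "\<dots> - ?T r = x ^ r + (\<Sum>k<r. of_nat ((n + Suc r) choose Suc k) * (-1) ^ Suc k * x ^ (r - Suc k))"
    by (simp add: algebra_simps sum_negf sum.distrib sum_subtractf)
  also have "\<dots> = ?T (Suc r)"
    by (subst sum.lessThan_Suc_shift) simp
  finally show ?case .
qed simp

text \<open>Choosing \<open>r + k\<close> out of \<open>n + r\<close> and then \<open>r\<close> of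
  these amounts to choosing \<open>r\<close> first and then \<open>k\<close> of the remaining
  \<open>n\<close>. The denominator on the right no longer depends on \<open>k\<close>.\<close>

lemma choose_div_choose:
  assumes "k \<le> n"
  shows "of_nat (n choose k) * inverse (of_nat ((r + k) choose r)) =
    (of_nat ((n + r) choose (r + k)) / of_nat ((n + r) choose r) :: 'a::field_char_0)"
proof -
  have "((n + r) choose (r + k)) * ((r + k) choose r) = ((n + r) choose r) * (n choose k)"
    using choose_mult[of r "r + k" "n + r"] assms by simp
  then have "of_nat ((n + r) choose (r + k)) * of_nat ((r + k) choose r) =
      (of_nat ((n + r) choose r) * of_nat (n choose k) :: 'a)"
    by (metis of_nat_mult)
  moreover have "of_nat ((r + k) choose r) \<noteq> (0::'a)" "of_nat ((n + r) choose r) \<noteq> (0::'a)"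
    by simp_all
  ultimately show ?thesis
    by (simp add: field_simps)
qed

lemma prod_add_eq_fact_mult_choose:
  "(\<Prod>i=1..r. of_nat (n + i)) = (fact r * of_nat ((n + r) choose r) :: 'a::field_char_0)"
proof (induction r)
  case (Suc r)
  have "Suc r * ((n + Suc r) choose Suc r) = (n + Suc r) * ((n + r) choose r)"
    using Suc_times_binomial_eq[of "n + r" r] by (simp add: mult.commute)
  then have "of_nat (Suc r) * of_nat ((n + Suc r) choose Suc r) =
      (of_nat (n + Suc r) * of_nat ((n + r) choose r) :: 'a)"
    by (metis of_nat_mult)
  then show ?case
    using Suc.IH by (simp add: prod.nat_ivl_Suc' mult_ac del: binomial_Suc_Suc of_nat_Suc of_nat_add)
qed simp

lemma smult_sum_right: "smult c (sum f A) = (\<Sum>i\<in>A. smult c (f i))"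
  by (induction A rule: infinite_finite_induct) (simp_all add: smult_add_right)

text \<open>Moving the scalars into the polynomial ring lets the identities for commutative rings be
  applied with \<open>x\<close> taken to be \<open>[:0, 1:]\<close>.\<close>

lemma smult_of_nat_neg_one_power:
  "smult (of_nat a * (-1) ^ k) p = of_nat a * (-1) ^ k * (p :: 'a::comm_ring_1 poly)"
  by (cases "even k") (simp_all add: of_nat_poly)

lemma monom_of_nat_neg_one_power:
  "monom (of_nat a * (-1) ^ k) m = of_nat a * (-1) ^ k * ([:0, 1:] ^ m :: 'a::comm_ring_1 poly)"
  by (simp add: monom_altdef smult_of_nat_neg_one_power)

lemma psi_poly_eq:
  "psi_poly r n = (\<Sum>k<r. of_nat ((n + r) choose k) * (-1) ^ k * [:0, 1:] ^ (r - 1 - k))"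
proof -
  have X: "[:-1, 1:] = ([:0, 1:] - 1 :: rat poly)" by (simp add: one_pCons)
  show ?thesis
    unfolding psi_poly_def smult_of_nat_neg_one_power X
    by (rule sum_binomial_diff_one_powers)
qed

lemma smult_choose_S_poly:
  "smult (of_nat ((n + r) choose r)) (S_poly r n) =
    (\<Sum>k\<le>n. of_nat ((n + r) choose (r + k)) * (-1) ^ k * [:0, 1:] ^ (n - k))"
proof -
  have "of_nat ((n + r) choose r) *
      (of_nat (n choose k) * (-1) ^ k * inverse (of_nat ((r + k) choose r))) =
      (of_nat ((n + r) choose (r + k)) * (-1) ^ k :: rat)" if "k \<le> n" for k
    using choose_div_choose[OF that, of r, where 'a = rat] by (simp add: field_simps)
  then show ?thesis
    unfolding S_poly_def atMost_atLeast0 smult_sum_right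
    by (intro sum.cong refl) (simp only: atLeastAtMost_iff smult_monom monom_of_nat_neg_one_power)
qed

lemma S_poly_eq:
  "S_poly r n = smult ((-1) ^ r * fact r / (\<Prod>i=1..r. of_nat (n + i)))
     ([:-1, 1:] ^ (r + n) - [:0, 1:] ^ (n + 1) * psi_poly r n)"
proof -
  let ?c = "of_nat ((n + r) choose r) :: rat"
  have X: "[:-1, 1:] = ([:0, 1:] - 1 :: rat poly)" by (simp add: one_pCons)
  have "[:-1, 1:] ^ (r + n) - [:0, 1:] ^ (n + 1) * psi_poly r n = (-1) ^ r * smult ?c (S_poly r n)"
    unfolding X psi_poly_eq smult_choose_S_poly
    by (subst binomial_diff_one_split) simp
  also have "\<dots> = smult ((-1) ^ r * ?c) (S_poly r n)"
    by (cases "even r") simp_all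
  finally have "[:-1, 1:] ^ (r + n) - [:0, 1:] ^ (n + 1) * psi_poly r n =
      smult ((-1) ^ r * ?c) (S_poly r n)" .
  \<comment> \<open>The sign \<open>(-1) ^ r\<close> is its own inverse, and the product is
    \<open>fact r * ?c\<close>, so the prefactor cancels exactly.\<close>
  moreover have "(-1) ^ r * fact r / (\<Prod>i=1..r. of_nat (n + i)) * ((-1) ^ r * ?c) = 1"
    unfolding prod_add_eq_fact_mult_choose
    by (simp add: field_simps flip: power_add mult_2)
  ultimately show ?thesis
    by (simp only: smult_smult smult_1_left)
qed

theorem theorem2p7:
  fixes n r :: nat
  assumes "n \<ge> 1" and "r \<ge> 1"
  shows "S_poly r n =
           smult ((-1) ^ r * fact r / (\<Prod>i=1..r. of_nat (n + i)))
             ([:-1, 1:] ^ (r + n) - [:0, 1:] ^ (n + 1) * psi_poly r n)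
    \<and> psi_poly r n =
           (\<Sum>k<r. monom (of_nat ((n + r) choose k) * (-1) ^ k) (r - 1 - k))
    \<and> S_poly 1 n = smult (1 / of_nat (n + 1)) ([:0, 1:] ^ (n + 1) - [:-1, 1:] ^ (n + 1))
    \<and> S_poly r 1 = [:0, 1:] - [:1 / of_nat (r + 1):]
    \<and> poly (S_poly r n) 2 =
           (-1) ^ r * fact r *
             ((1 - 2 ^ (n + 1) * (\<Sum>k<r. (-1) ^ k * of_nat ((n + k) choose k)))
               / (\<Prod>i=1..r. of_nat (n + i)))"
proof (intro conjI)
  show "S_poly r n = smult ((-1) ^ r * fact r / (\<Prod>i=1..r. of_nat (n + i)))
      ([:-1, 1:] ^ (r + n) - [:0, 1:] ^ (n + 1) * psi_poly r n)"
    by (rule S_poly_eq)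
  show "psi_poly r n = (\<Sum>k<r. monom (of_nat ((n + r) choose k) * (-1) ^ k) (r - 1 - k))"
    unfolding monom_of_nat_neg_one_power by (rule psi_poly_eq)
  \<comment> \<open>For \<open>r = 1\<close> the sum \<open>psi_poly\<close> is 1 and the prefactor
    is negative; moving its sign inside swaps the difference.\<close>
  have "S_poly 1 n = smult (- (1 / of_nat (n + 1))) ([:-1, 1:] ^ (n + 1) - [:0, 1:] ^ (n + 1))"
    using S_poly_eq[of 1 n] by (simp add: psi_poly_def)
  then show "S_poly 1 n = smult (1 / of_nat (n + 1)) ([:0, 1:] ^ (n + 1) - [:-1, 1:] ^ (n + 1))"
    by (simp only: smult_minus_left flip: smult_minus_right) simp
  \<comment> \<open>For \<open>n = 1\<close> the definition of \<open>S_poly\<close> has just two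
    terms, so it is evaluated directly.\<close>
  have "Suc r choose r = Suc r"
    using binomial_symmetric[of r "Suc r"] by simp
  then show "S_poly r 1 = [:0, 1:] - [:1 / of_nat (r + 1):]"
    by (simp add: S_poly_def monom_altdef divide_inverse)
  \<comment> \<open>At 2 every power of \<open>x - 1\<close> equals 1, so the defining form of
    \<open>psi_poly\<close> is the convenient one.\<close>
  have "poly (psi_poly r n) 2 = (\<Sum>k<r. (-1) ^ k * of_nat ((n + k) choose k))"
    unfolding psi_poly_def poly_sum by (simp add: mult.commute)
  then show "poly (S_poly r n) 2 = (-1) ^ r * fact r *
      ((1 - 2 ^ (n + 1) * (\<Sum>k<r. (-1) ^ k * of_nat ((n + k) choose k)))
        / (\<Prod>i=1..r. of_nat (n + i)))"
    by (subst S_poly_eq) (simp add: poly_power)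
qed

end
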